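(* Let $\mathcal G=(\mathcal V,\mathcal E)$ be a tree-shaped network. Then the steady-state gas flow model for mixtures on $\mathcal G$ admits a unique solution.
   Context: Network: $\mathcal G=(\mathcal V,\mathcal E)$ is a connected directed graph, $\mathcal E\subseteq\mathcal V\times\mathcal V$. An edge is $e=(f(e),h(e))$ with start node $f(e)$ and end node $h(e)$; $\mathcal E(v)$ is the set of edges incident to $v$. The network is tree-shaped if it has no cycles (cycles are understood irrespective of edge orientation). The incidence matrix $A$ has entries $a(v,e)=-1$ if $v=f(e)$, $a(v,e)=1$ if $v=h(e)$, and $a(v,e)=0$ otherwise. Data: constants $\lambda_{\mathrm{Fr}}>0$ (friction factor), $D$ (pipe diameter), $\sigma_{\mathrm{H}_2}$, $\sigma_{\mathrm{NG}}$ (speeds of sound in hydrogen and natural gas), and pipe lengths $L^e$. $\mathcal V$ is the disjoint union of the supply nodes $\mathcal V_{<0}$ and the demand nodes $\mathcal V_{\ge0}$. Loads $b_v$ are given for all $v\in\mathcal V$, with $b_v<0$ for $v\in\mathcal V_{<0}$, $b_v\ge0$ for $v\in\mathcal V_{\ge0}$, and $\sum_{v\in\mathcal V}b_v=0$. Supply compositions $\zeta_v$ (hydrogen fractions) are given for $v\in\mathcal V_{<0}$. At one fixed node $v^\ast\in\mathcal V$ a pressure $p^\ast$ is prescribed. Notation: $\alpha^+=\max\{\alpha,0\}$, $\alpha^-=\max\{-\alpha,0\}$; $\sigma(\eta)=\eta\,\sigma_{\mathrm{H}_2}^2+(1-\eta)\,\sigma_{\mathrm{NG}}^2$; and $$\tilde\sigma(\eta_{f(e)},\eta_{h(e)},q_e)=-\frac{\lambda_{\mathrm{Fr}}}{D}L^e\Big[\tfrac12\Big(\tfrac{|q_e|}{q_e}+1\Big)\sigma(\eta_{f(e)})-\tfrac12\Big(\tfrac{|q_e|}{q_e}-1\Big)\sigma(\eta_{h(e)})\Big],$$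 where the product $\tilde\sigma(\eta_{f(e)},\eta_{h(e)},q_e)\,q_e|q_e|$ has a removable singularity at $q_e=0$ (with value $0$). The composition on an edge is $\eta_e=\eta_{f(e)}$ if $q_e\ge0$ and $\eta_e=\eta_{h(e)}$ if $q_e<0$. The steady-state gas flow model for mixtures: the unknowns are the flows $q_e$ ($e\in\mathcal E$), the nodal compositions $\eta_v$ and the nodal pressures $p_v$ ($v\in\mathcal V$), with $p_{v^\ast}=p^\ast$, and a solution satisfies $$p_{h(e)}^2-p_{f(e)}^2=\tilde\sigma(\eta_{f(e)},\eta_{h(e)},q_e)\,q_e|q_e|\quad\text{for all } e\in\mathcal E,$$ $$\sum_{e\in\mathcal E(v)}a(v,e)q_e=b_v\quad\text{for all } v\in\mathcal V,$$ $$\eta_v=\frac{\sum_{e\in\mathcal E(v)}\eta_e\,(a(v,e)q_e)^+ +\zeta_v b_v^-}{\sum_{e\in\mathcal E(v)}(a(v,e)q_e)^+ + b_v^-}\quad\text{for all } v\in\mathcal V,$$ where the term $\zeta_v b_v^-$ is present only at supply nodes (it is $0$ if $b_v\ge0$).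
   Formalization: Pressures are taken nonnegative and exist (uniquely) exactly when p* is at least a threshold, since for small p* some squared pressure is negative; squared pressures are unique for every p*; at nodes with no inflow, where η_v is 0/0, an arbitrary fixed value is used. *)

theory Defs
  imports Complex_Main "HOL-Library.FuncSet" "Graph_Theory.Graph_Theory"
begin

text \<open>
  An edge is a pair \<open>e = (f(e), h(e))\<close>, so \<open>f\<close> and \<open>h\<close> are \<^const>\<open>fst\<close> and \<^const>\<open>snd\<close>.
  The prescribed pressure at \<open>ref_node\<close> is not part of the record; it is a separate argument
  of the solution predicates below.
\<close>

record 'v gas_network =
  graph :: "'v pair_pre_digraph"
  friction :: real
  diameter :: real
  sound_speed_H2 :: real
  sound_speed_NG :: real
  pipe_length :: "'v \<times> 'v \<Rightarrow> real"
  supply_nodes :: "'v set"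
  demand_nodes :: "'v set"
  load :: "'v \<Rightarrow> real"
  supply_composition :: "'v \<Rightarrow> real"
  ref_node :: 'v

abbreviation nodes :: "('v, 'z) gas_network_scheme \<Rightarrow> 'v set" where
  "nodes N \<equiv> pverts (graph N)"

abbreviation edges :: "('v, 'z) gas_network_scheme \<Rightarrow> ('v \<times> 'v) set" where
  "edges N \<equiv> parcs (graph N)"

text \<open>
  Connectedness is the library's notion for digraphs, which ignores orientation. No sign
  conditions on the sound speeds and the pipe lengths are imposed.
\<close>

definition well_posed_network :: "'v gas_network \<Rightarrow> bool" where
  "well_posed_network N \<longleftrightarrow>
     pair_fin_digraph (graph N) \<and>
     Digraph_Component.connected (with_proj (graph N)) \<and>
     friction N > 0 \<and> diameter N > 0 \<and>
     supply_nodes N \<union> demand_nodes N = nodes N \<and>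
     supply_nodes N \<inter> demand_nodes N = {} \<and>
     (\<forall>v\<in>supply_nodes N. load N v < 0) \<and>
     (\<forall>v\<in>demand_nodes N. load N v \<ge> 0) \<and>
     (\<Sum>v\<in>nodes N. load N v) = 0 \<and>
     ref_node N \<in> nodes N"

text \<open>
  Cycles irrespective of orientation: every edge \<open>e\<close> gives an arc \<open>(e, True)\<close> along \<open>e\<close> and
  an arc \<open>(e, False)\<close> against it. A cycle of the network is a cycle of this multigraph that
  uses no edge twice, so going back and forth on one edge is not a cycle, whereas a
  self-loop or a pair of antiparallel edges is one.
\<close>

definition two_way :: "'v pair_pre_digraph \<Rightarrow> ('v, ('v \<times> 'v) \<times> bool) pre_digraph" where
  "two_way G = \<lparr> verts = pverts G, arcs = parcs G \<times> UNIV,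
     tail = (\<lambda>(e, forward). if forward then fst e else snd e),
     head = (\<lambda>(e, forward). if forward then snd e else fst e) \<rparr>"

definition tree_shaped :: "'v pair_pre_digraph \<Rightarrow> bool" where
  "tree_shaped G \<longleftrightarrow>
     \<not> (\<exists>p. pre_digraph.cycle (two_way G) p \<and> distinct (map fst p))"

definition incident_edges :: "'v gas_network \<Rightarrow> 'v \<Rightarrow> ('v \<times> 'v) set" where
  "incident_edges N v = {e \<in> edges N. v = fst e \<or> v = snd e}"

definition incidence :: "'v \<Rightarrow> 'v \<times> 'v \<Rightarrow> real" where
  "incidence v e = (if v = fst e then - 1 else if v = snd e then 1 else 0)"

definition pos_part :: "real \<Rightarrow> real" where
  "pos_part x = max x 0"

definition neg_part :: "real \<Rightarrow> real" where
  "neg_part x = max (- x) 0"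

definition sigma :: "'v gas_network \<Rightarrow> real \<Rightarrow> real" where
  "sigma N x = x * (sound_speed_H2 N)\<^sup>2 + (1 - x) * (sound_speed_NG N)\<^sup>2"

text \<open>
  The removable singularity at \<open>q = 0\<close> needs no case distinction: \<open>sigma_tilde\<close> is only used
  in the product with \<open>q * \<bar>q\<bar>\<close>, which is \<open>0\<close> for \<open>q = 0\<close>.
\<close>

definition sigma_tilde :: "'v gas_network \<Rightarrow> 'v \<times> 'v \<Rightarrow> real \<Rightarrow> real \<Rightarrow> real \<Rightarrow> real" where
  "sigma_tilde N e \<eta>f \<eta>h q =
     - (friction N / diameter N) * pipe_length N e *
       (1/2 * (\<bar>q\<bar> / q + 1) * sigma N \<eta>f - 1/2 * (\<bar>q\<bar> / q - 1) * sigma N \<eta>h)"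

definition edge_composition ::
  "('v \<times> 'v \<Rightarrow> real) \<Rightarrow> ('v \<Rightarrow> real) \<Rightarrow> 'v \<times> 'v \<Rightarrow> real" where
  "edge_composition q \<eta> e = (if q e \<ge> 0 then \<eta> (fst e) else \<eta> (snd e))"

text \<open>The argument \<open>psq\<close> stands for the squared pressures.\<close>

definition pressure_law ::
  "'v gas_network \<Rightarrow> ('v \<times> 'v \<Rightarrow> real) \<Rightarrow> ('v \<Rightarrow> real) \<Rightarrow> ('v \<Rightarrow> real) \<Rightarrow> bool" where
  "pressure_law N q \<eta> psq \<longleftrightarrow>
     (\<forall>e\<in>edges N. psq (snd e) - psq (fst e) =
        sigma_tilde N e (\<eta> (fst e)) (\<eta> (snd e)) (q e) * (q e * \<bar>q e\<bar>))"

definition mass_balance :: "'v gas_network \<Rightarrow> ('v \<times> 'v \<Rightarrow> real) \<Rightarrow> bool" where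
  "mass_balance N q \<longleftrightarrow>
     (\<forall>v\<in>nodes N. (\<Sum>e\<in>incident_edges N v. incidence v e * q e) = load N v)"

definition inflow :: "'v gas_network \<Rightarrow> ('v \<times> 'v \<Rightarrow> real) \<Rightarrow> 'v \<Rightarrow> real" where
  "inflow N q v =
     (\<Sum>e\<in>incident_edges N v. pos_part (incidence v e * q e)) + neg_part (load N v)"

text \<open>
  The composition at a node is the quotient of the hydrogen inflow and the total inflow. At a
  node without any inflow (a node with load \<open>0\<close> all of whose edges carry no flow) this
  quotient is \<open>0/0\<close> and the model does not determine a composition. The argument \<open>\<eta>0\<close> is an
  arbitrary convention for the composition at such nodes and is not used anywhere else;
  \<open>\<eta>0 = (\<lambda>_. 0)\<close> gives the plain quotient with \<open>x / 0 = 0\<close>.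
\<close>

definition mixing_law ::
  "'v gas_network \<Rightarrow> ('v \<Rightarrow> real) \<Rightarrow> ('v \<times> 'v \<Rightarrow> real) \<Rightarrow> ('v \<Rightarrow> real) \<Rightarrow> bool" where
  "mixing_law N \<eta>0 q \<eta> \<longleftrightarrow>
     (\<forall>v\<in>nodes N. \<eta> v =
        (if inflow N q v = 0 then \<eta>0 v
         else ((\<Sum>e\<in>incident_edges N v.
                  edge_composition q \<eta> e * pos_part (incidence v e * q e))
               + (if v \<in> supply_nodes N
                  then supply_composition N v * neg_part (load N v) else 0))
              / inflow N q v))"

text \<open>
  The unknowns are indexed by edges and nodes; as total functions they are normalised to
  \<^const>\<open>undefined\<close> outside these sets, so that uniqueness is equality on the network.
  Pressures are nonnegative, since the equations only involve their squares.
\<close>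

definition steady_state ::
  "'v gas_network \<Rightarrow> ('v \<Rightarrow> real) \<Rightarrow> real \<Rightarrow>
   ('v \<times> 'v \<Rightarrow> real) \<times> ('v \<Rightarrow> real) \<times> ('v \<Rightarrow> real) \<Rightarrow> bool" where
  "steady_state N \<eta>0 pstar = (\<lambda>(q, \<eta>, p).
     q \<in> extensional (edges N) \<and> \<eta> \<in> extensional (nodes N) \<and> p \<in> extensional (nodes N) \<and>
     (\<forall>v\<in>nodes N. p v \<ge> 0) \<and>
     p (ref_node N) = pstar \<and>
     pressure_law N q \<eta> (\<lambda>v. (p v)\<^sup>2) \<and>
     mass_balance N q \<and>
     mixing_law N \<eta>0 q \<eta>)"

text \<open>
  The same model with the squared pressures as unknowns, without a sign condition: if \<open>pstar\<close>
  is too small, friction can make the value at some node negative, and then there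
  are no actual pressures.
\<close>

definition steady_state_squared ::
  "'v gas_network \<Rightarrow> ('v \<Rightarrow> real) \<Rightarrow> real \<Rightarrow>
   ('v \<times> 'v \<Rightarrow> real) \<times> ('v \<Rightarrow> real) \<times> ('v \<Rightarrow> real) \<Rightarrow> bool" where
  "steady_state_squared N \<eta>0 pstar = (\<lambda>(q, \<eta>, psq).
     q \<in> extensional (edges N) \<and> \<eta> \<in> extensional (nodes N) \<and> psq \<in> extensional (nodes N) \<and>
     psq (ref_node N) = pstar\<^sup>2 \<and>
     pressure_law N q \<eta> psq \<and>
     mass_balance N q \<and>
     mixing_law N \<eta>0 q \<eta>)"

end

theory Submission
  imports Defs
begin

text \<open>
  On a tree the three groups of equations decouple and can be solved one after the other.

  A connected network without cycles is built from a single node by attaching one leaf at a time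
  (\<open>grown_tree_if_connected_tree_shaped\<close>). At a leaf, mass balance fixes the flow on the only
  incident edge, and the load of the leaf is passed on to its neighbour; hence balanced loads
  determine all flows (\<open>grown_tree_unique_flow\<close>). The same induction shows that prescribed
  differences along the edges come from a potential that is unique up to a constant
  (\<open>grown_tree_potential_exists\<close>, \<open>grown_tree_potential_constant\<close>).

  Once the flows are known, the composition at a node depends only on the compositions directly
  upstream of it. Taking the sign of the flow as the prescribed difference, one gets a potential
  that increases along the flow, so gas never circulates, and the compositions are determined by
  recursion from the sources downstream (\<open>grown_tree_unique_composition\<close>).

  Finally, flows and compositions turn the right-hand side of the pressure law into known
  numbers, one for each edge, so that the squared pressures form a potential with prescribed
  differences and a prescribed value at the reference node. They have the form
  \<open>pstar\<^sup>2 + \<psi> v\<close> with \<open>\<psi>\<close> independent of \<open>pstar\<close>. Pressures proper exist if and only if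
  \<open>pstar \<ge> 0\<close> and all these values are nonnegative, that is, if and only if \<open>pstar\<close> is at
  least the square root of the largest \<open>- \<psi> v\<close>; this maximum is nonnegative because \<open>\<psi>\<close>
  vanishes at the reference node.
\<close>

section \<open>Trees grown leaf by leaf\<close>

text \<open>
  Trees are captured by their growth, since flows and potentials are both determined by peeling
  off leaves. The orientation of an edge only fixes the sign of its flow and is not tied to the
  direction of growth.
\<close>

inductive grown_tree :: "'v set \<Rightarrow> ('v \<times> 'v) set \<Rightarrow> bool" where
  root: "grown_tree {v} {}"
| leaf: "grown_tree V E \<Longrightarrow> u \<in> V \<Longrightarrow> w \<notin> V \<Longrightarrow> e = (u, w) \<or> e = (w, u)
    \<Longrightarrow> grown_tree (insert w V) (insert e E)"

lemma grown_tree_finite_nodes: "grown_tree V E \<Longrightarrow> finite V"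
  by (induction rule: grown_tree.induct) auto

lemma grown_tree_finite_edges: "grown_tree V E \<Longrightarrow> finite E"
  by (induction rule: grown_tree.induct) auto

lemma grown_tree_edges_subset: "grown_tree V E \<Longrightarrow> E \<subseteq> V \<times> V"
  by (induction rule: grown_tree.induct) auto

lemma two_way_tail_head [simp]:
  "tail (two_way G) (e, True) = fst e" "head (two_way G) (e, True) = snd e"
  "tail (two_way G) (e, False) = snd e" "head (two_way G) (e, False) = fst e"
  by (auto simp: two_way_def)

lemma cas_append_arc:
  "pre_digraph.cas G u (p @ [a]) v \<longleftrightarrow> pre_digraph.cas G u p (tail G a) \<and> head G a = v"
  by (induction p arbitrary: u) (auto simp: pre_digraph.cas.simps)

lemma awalk_verts_append_arc:
  assumes "pre_digraph.cas G u p (tail G a)"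
  shows "pre_digraph.awalk_verts G u (p @ [a]) = pre_digraph.awalk_verts G u p @ [head G a]"
  using assms
  by (induction p arbitrary: u) (auto simp: pre_digraph.cas.simps pre_digraph.awalk_verts.simps)

text \<open>
  A new leaf is reached through its neighbour, and as neither the leaf nor its edge occurs in the
  smaller tree, the extended path still repeats nothing. Both kinds of distinctness go into the
  cycles of \<open>tree_shaped_unique_link\<close>.
\<close>

lemma grown_tree_path:
  assumes "grown_tree V E" "a \<in> V" "b \<in> V"
  shows "\<exists>p. pre_digraph.cas (two_way G) a p b \<and> set p \<subseteq> E \<times> UNIV \<and> distinct (map fst p) \<and>
    set (pre_digraph.awalk_verts (two_way G) a p) \<subseteq> V \<and>
    distinct (pre_digraph.awalk_verts (two_way G) a p)"
  using assms
proof (induction arbitrary: a b rule: grown_tree.induct)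
  case (root v)
  then show ?case
    by (intro exI[of _ "[]"]) (auto simp: pre_digraph.cas.simps pre_digraph.awalk_verts.simps)
next
  case (leaf V E u w e)
  have eE: "e \<notin> E"
    using grown_tree_edges_subset[OF leaf.hyps(1)] leaf.hyps by auto
  obtain out into where
    out: "tail (two_way G) (e, out) = w" "head (two_way G) (e, out) = u" and
    into: "tail (two_way G) (e, into) = u" "head (two_way G) (e, into) = w"
    using leaf.hyps(4) by (metis fst_conv snd_conv two_way_tail_head)
  consider (old) "a \<in> V" "b \<in> V" | (both) "a = w" "b = w" | (start) "a = w" "b \<in> V"
    | ("end") "a \<in> V" "b = w"
    using leaf.prems by auto
  then show ?case
  proof cases
    case old
    with leaf.IH show ?thesis by blast
  next
    case both
    then show ?thesis
      by (intro exI[of _ "[]"]) (auto simp: pre_digraph.cas.simps pre_digraph.awalk_verts.simps)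
  next
    case start
    obtain p where p: "pre_digraph.cas (two_way G) u p b" "set p \<subseteq> E \<times> UNIV"
      "distinct (map fst p)" "set (pre_digraph.awalk_verts (two_way G) u p) \<subseteq> V"
      "distinct (pre_digraph.awalk_verts (two_way G) u p)"
      using leaf.IH[OF leaf.hyps(2) start(2)] by blast
    show ?thesis
      using p out start eE leaf.hyps(3)
      by (intro exI[of _ "(e, out) # p"])
        (auto simp: pre_digraph.cas.simps pre_digraph.awalk_verts.simps)
  next
    case "end"
    obtain p where p: "pre_digraph.cas (two_way G) a p u" "set p \<subseteq> E \<times> UNIV"
      "distinct (map fst p)" "set (pre_digraph.awalk_verts (two_way G) a p) \<subseteq> V"
      "distinct (pre_digraph.awalk_verts (two_way G) a p)"
      using leaf.IH[OF "end"(1) leaf.hyps(2)] by blast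
    show ?thesis
      using p into "end" eE leaf.hyps(3)
      by (intro exI[of _ "p @ [(e, into)]"])
        (auto simp: cas_append_arc awalk_verts_append_arc)
  qed
qed

lemma tree_shaped_no_loop:
  assumes "tree_shaped G" "v \<in> pverts G"
  shows "(v, v) \<notin> parcs G"
proof
  assume "(v, v) \<in> parcs G"
  then have "pre_digraph.cycle (two_way G) [((v, v), True)]"
    using assms(2)
    by (auto simp: pre_digraph.cycle_def pre_digraph.awalk_def pre_digraph.cas.simps
        pre_digraph.awalk_verts.simps two_way_def)
  then show False
    using assms(1) unfolding tree_shaped_def by force
qed

text \<open>
  Two edges from a grown subtree to the same outside node would close a cycle with the path in
  the subtree between their other end nodes.
\<close>

lemma tree_shaped_unique_link:
  assumes tree: "tree_shaped G" and VG: "V \<subseteq> pverts G" "E \<subseteq> parcs G"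
    and grown: "grown_tree V E" and w: "w \<in> pverts G" "w \<notin> V"
    and u: "u \<in> V" "e = (u, w) \<or> e = (w, u)" "e \<in> parcs G"
    and u': "u' \<in> V" "e' = (u', w) \<or> e' = (w, u')" "e' \<in> parcs G"
  shows "e = e'"
proof (rule ccontr)
  assume ne: "e \<noteq> e'"
  let ?T = "two_way G"
  have eE: "e \<notin> E" "e' \<notin> E"
    using grown_tree_edges_subset[OF grown] w u u' by auto
  obtain out where out: "tail ?T (e', out) = w" "head ?T (e', out) = u'"
    using u'(2) by (metis fst_conv snd_conv two_way_tail_head)
  obtain into where into: "tail ?T (e, into) = u" "head ?T (e, into) = w"
    using u(2) by (metis fst_conv snd_conv two_way_tail_head)
  obtain p where p: "pre_digraph.cas ?T u' p u" "set p \<subseteq> E \<times> UNIV" "distinct (map fst p)"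
    "set (pre_digraph.awalk_verts ?T u' p) \<subseteq> V" "distinct (pre_digraph.awalk_verts ?T u' p)"
    using grown_tree_path[OF grown u'(1) u(1), of G] by blast
  let ?c = "(e', out) # p @ [(e, into)]"
  have "pre_digraph.awalk ?T w ?c w"
    using p out into w VG u u'
    by (auto simp: pre_digraph.awalk_def pre_digraph.cas.simps cas_append_arc two_way_def)
  moreover have "distinct (tl (pre_digraph.awalk_verts ?T w ?c))"
    using p out into w by (auto simp: pre_digraph.awalk_verts.simps awalk_verts_append_arc)
  ultimately have "pre_digraph.cycle ?T ?c"
    unfolding pre_digraph.cycle_def by blast
  moreover have "distinct (map fst ?c)"
    using p ne eE by auto
  ultimately show False
    using tree unfolding tree_shaped_def by blast
qed

lemma connected_crossing_edge:
  assumes "Digraph_Component.connected (with_proj G)" "S \<subseteq> pverts G" "a \<in> S" "b \<in> pverts G" "b \<notin> S"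
  obtains u w e where "u \<in> S" "w \<in> pverts G" "w \<notin> S" "e \<in> parcs G" "e = (u, w) \<or> e = (w, u)"
proof -
  have "a \<rightarrow>\<^sup>*\<^bsub>with_proj (mk_symmetric (with_proj G))\<^esub> b"
    using assms unfolding connected_def strongly_connected_def by auto
  then have "(a, b) \<in> rtrancl_on (pverts G) (parcs (mk_symmetric (with_proj G)))"
    unfolding reachable_def by simp
  then have "b \<in> S \<or> (\<exists>u w e. u \<in> S \<and> w \<in> pverts G \<and> w \<notin> S \<and> e \<in> parcs G \<and>
      (e = (u, w) \<or> e = (w, u)))"
  proof (induction rule: rtrancl_on_induct)
    case base
    with assms show ?case by simp
  next
    case (step y z)
    then have "(y, z) \<in> parcs G \<or> (z, y) \<in> parcs G"
      by (auto simp: parcs_mk_symmetric)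
    with step show ?case by blast
  qed
  with assms that show ?thesis by blast
qed

text \<open>
  A grown subtree that contains all edges between its nodes and is as large as possible spans the
  network: otherwise a crossing edge leads to a new node, and since this edge is the only link
  to it, attaching it as a leaf again gives all edges between the nodes.
\<close>

lemma grown_tree_if_connected_tree_shaped:
  assumes fin: "pair_fin_digraph G" and conn: "Digraph_Component.connected (with_proj G)"
    and tree: "tree_shaped G" and r: "r \<in> pverts G"
  shows "grown_tree (pverts G) (parcs G)"
proof -
  interpret pair_fin_digraph G by (rule fin)
  define good where
    "good S \<longleftrightarrow> S \<subseteq> pverts G \<and> S \<noteq> {} \<and> grown_tree S (parcs G \<inter> S \<times> S)" for S
  have "parcs G \<inter> {r} \<times> {r} = {}"
    using tree_shaped_no_loop[OF tree r] by auto
  then have "good {r}"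
    using r by (simp add: good_def grown_tree.root)
  moreover have "finite {S. good S}"
    by (rule finite_subset[of _ "Pow (pverts G)"]) (auto simp: good_def)
  ultimately obtain S where S: "good S" and max: "\<And>S'. good S' \<Longrightarrow> S \<subseteq> S' \<Longrightarrow> S' = S"
    using finite_has_maximal[of "{S. good S}"] by fastforce
  have "S = pverts G"
  proof (rule ccontr)
    assume "S \<noteq> pverts G"
    moreover have sub: "S \<subseteq> pverts G" and "S \<noteq> {}"
      using S by (auto simp: good_def)
    ultimately obtain a b where "a \<in> S" "b \<in> pverts G" "b \<notin> S"
      by blast
    then obtain u w e where e: "u \<in> S" "w \<in> pverts G" "w \<notin> S" "e \<in> parcs G"
      "e = (u, w) \<or> e = (w, u)"
      by (rule connected_crossing_edge[OF conn sub])
    have grown: "grown_tree S (parcs G \<inter> S \<times> S)"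
      using S by (simp add: good_def)
    have "e' = e" if "e' \<in> parcs G" "u' \<in> S" "e' = (u', w) \<or> e' = (w, u')" for e' u'
      by (rule tree_shaped_unique_link[OF tree sub _ grown e(2,3) that(2,3,1) e(1,5,4)]) simp
    moreover have "(w, w) \<notin> parcs G"
      using tree_shaped_no_loop[OF tree e(2)] .
    ultimately have "parcs G \<inter> insert w S \<times> insert w S = insert e (parcs G \<inter> S \<times> S)"
      using e(1,4,5) by blast
    then have "good (insert w S)"
      using grown_tree.leaf[OF grown e(1,3,5)] sub e(2) by (simp add: good_def)
    then show False
      using max[of "insert w S"] e(3) by blast
  qed
  moreover have "parcs G \<inter> pverts G \<times> pverts G = parcs G"
    using in_arcsD1 in_arcsD2 by auto
  ultimately show ?thesis
    using S by (simp add: good_def)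
qed

section \<open>Potentials and flows on grown trees\<close>

lemma grown_tree_potential_exists:
  fixes d :: "'v \<times> 'v \<Rightarrow> real"
  assumes "grown_tree V E"
  shows "\<exists>\<psi>. \<forall>e\<in>E. \<psi> (snd e) - \<psi> (fst e) = d e"
  using assms
proof (induction rule: grown_tree.induct)
  case (leaf V E u w e)
  then obtain \<psi> where \<psi>: "\<forall>e\<in>E. \<psi> (snd e) - \<psi> (fst e) = d e" by blast
  have old: "fst e' \<noteq> w \<and> snd e' \<noteq> w" if "e' \<in> E" for e'
    using grown_tree_edges_subset[OF leaf.hyps(1)] leaf.hyps(3) that by auto
  show ?case
    using leaf.hyps \<psi> old
    by (intro exI[of _ "\<psi>(w := if e = (u, w) then \<psi> u + d e else \<psi> u - d e)"]) auto
qed simp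

lemma grown_tree_potential_constant:
  assumes "grown_tree V E" "\<forall>e\<in>E. \<phi> (snd e) = \<phi> (fst e)" "a \<in> V" "b \<in> V"
  shows "\<phi> a = \<phi> b"
  using assms
proof (induction arbitrary: a b rule: grown_tree.induct)
  case (leaf V E u w e)
  have "\<phi> (snd e) = \<phi> (fst e)"
    using leaf.prems(1) by blast
  then have "\<phi> w = \<phi> u"
    using leaf.hyps(4) by auto
  moreover have "\<phi> x = \<phi> u" if "x \<in> V" for x
    using leaf.IH[OF _ that leaf.hyps(2)] leaf.prems(1) by blast
  ultimately have "\<phi> x = \<phi> u" if "x \<in> insert w V" for x
    using that by blast
  from this[OF leaf.prems(2)] this[OF leaf.prems(3)] show ?case by simp
qed simp

lemma grown_tree_unique_potential:
  fixes d :: "'v \<times> 'v \<Rightarrow> real"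
  assumes grown: "grown_tree V E" and r: "r \<in> V"
  shows "\<exists>!\<psi>. \<psi> \<in> extensional V \<and> \<psi> r = c \<and> (\<forall>e\<in>E. \<psi> (snd e) - \<psi> (fst e) = d e)"
proof (rule ex_ex1I)
  obtain \<psi> where \<psi>: "\<forall>e\<in>E. \<psi> (snd e) - \<psi> (fst e) = d e"
    using grown_tree_potential_exists[OF grown] by blast
  have "fst e \<in> V \<and> snd e \<in> V" if "e \<in> E" for e
    using grown_tree_edges_subset[OF grown] that by auto
  with \<psi> r show "\<exists>\<psi>. \<psi> \<in> extensional V \<and> \<psi> r = c \<and> (\<forall>e\<in>E. \<psi> (snd e) - \<psi> (fst e) = d e)"
    by (intro exI[of _ "\<lambda>v\<in>V. \<psi> v - \<psi> r + c"]) simp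
next
  fix \<psi> \<psi>'
  assume \<psi>: "\<psi> \<in> extensional V \<and> \<psi> r = c \<and> (\<forall>e\<in>E. \<psi> (snd e) - \<psi> (fst e) = d e)"
    and \<psi>': "\<psi>' \<in> extensional V \<and> \<psi>' r = c \<and> (\<forall>e\<in>E. \<psi>' (snd e) - \<psi>' (fst e) = d e)"
  have "\<psi> (snd e) - \<psi>' (snd e) = \<psi> (fst e) - \<psi>' (fst e)" if "e \<in> E" for e
  proof -
    have "\<psi> (snd e) - \<psi> (fst e) = \<psi>' (snd e) - \<psi>' (fst e)"
      using \<psi> \<psi>' that by simp
    then show ?thesis by linarith
  qed
  then have "\<psi> v - \<psi>' v = \<psi> r - \<psi>' r" if "v \<in> V" for v
    using grown_tree_potential_constant[OF grown _ that r, of "\<lambda>v. \<psi> v - \<psi>' v"] by blast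
  then have "\<psi> v = \<psi>' v" if "v \<in> V" for v
    using \<psi> \<psi>' that by simp
  with \<psi> \<psi>' show "\<psi> = \<psi>'"
    by (blast intro: extensionalityI)
qed

text \<open>
  The flow on the edge of a leaf must carry exactly the load of the leaf; what remains is the flow
  problem on the smaller tree in which the neighbour has taken over this load. At the root the
  condition on the total load is the balance itself.
\<close>

lemma grown_tree_unique_flow:
  assumes "grown_tree V E" "(\<Sum>v\<in>V. b v) = 0"
  shows "\<exists>!q. q \<in> extensional E \<and> (\<forall>v\<in>V. (\<Sum>e\<in>E. incidence v e * q e) = b v)"
  using assms
proof (induction arbitrary: b rule: grown_tree.induct)
  case (root v)
  then show ?case by auto
next
  case (leaf V E u w e)
  note finE = grown_tree_finite_edges[OF leaf.hyps(1)]
    and finV = grown_tree_finite_nodes[OF leaf.hyps(1)]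
    and sub = grown_tree_edges_subset[OF leaf.hyps(1)]
  have eE: "e \<notin> E" using sub leaf.hyps by auto
  have uw: "u \<noteq> w" using leaf.hyps by auto
  define s where "s = incidence w e"
  have s: "s = 1 \<or> s = - 1" "incidence u e = - s"
    using leaf.hyps(4) uw by (auto simp: s_def incidence_def)
  have far: "incidence v e = 0" if "v \<in> V" "v \<noteq> u" for v
    using leaf.hyps that by (auto simp: incidence_def)
  have leaf_old: "(\<Sum>e\<in>E. incidence w e * q e) = 0" for q
    by (rule sum.neutral) (use sub leaf.hyps(3) in \<open>auto simp: incidence_def\<close>)
  define b' where "b' = b(u := b u + b w)"
  have "(\<Sum>v\<in>V. b' v) = (\<Sum>v\<in>V. b v + (if v = u then b w else 0))"
    by (rule sum.cong) (auto simp: b'_def)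
  also have "\<dots> = (\<Sum>v\<in>V. b v) + b w"
    using finV leaf.hyps(2) by (simp add: sum.distrib)
  also have "\<dots> = 0"
    using leaf.prems leaf.hyps(3) finV by simp
  finally have "(\<Sum>v\<in>V. b' v) = 0" .
  from leaf.IH[OF this] obtain q0 where
    q0: "q0 \<in> extensional E" "\<forall>v\<in>V. (\<Sum>e\<in>E. incidence v e * q0 e) = b' v"
    and q0_unique: "\<And>q. q \<in> extensional E \<Longrightarrow>
      \<forall>v\<in>V. (\<Sum>e\<in>E. incidence v e * q e) = b' v \<Longrightarrow> q = q0"
    by blast
  \<comment> \<open>the flow problem on the larger tree splits into the leaf and the smaller tree\<close>
  have split: "(\<forall>v\<in>insert w V. (\<Sum>e\<in>insert e E. incidence v e * q e) = b v) \<longleftrightarrow>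
      q e = s * b w \<and> (\<forall>v\<in>V. (\<Sum>e\<in>E. incidence v e * q e) = b' v)" for q
  proof -
    have "s * q e = b w \<longleftrightarrow> q e = s * b w"
      using s(1) by (elim disjE; simp; arith)
    moreover have "incidence v e * q e + (\<Sum>e\<in>E. incidence v e * q e) = b v \<longleftrightarrow>
        (\<Sum>e\<in>E. incidence v e * q e) = b' v" if "v \<in> V" "s * q e = b w" for v
      using that s(2) far[of v] by (cases "v = u") (auto simp: b'_def)
    ultimately show ?thesis
      using finE eE leaf_old[of q] by (auto simp flip: s_def)
  qed
  have restr: "(\<Sum>e'\<in>E. incidence v e' * (q0(e := x)) e') = (\<Sum>e'\<in>E. incidence v e' * q0 e')"
    "(\<Sum>e\<in>E. incidence v e * restrict q E e) = (\<Sum>e\<in>E. incidence v e * q e)" for v x q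
    using eE by (auto intro!: sum.cong)
  show ?case
    unfolding split
  proof (rule ex1I[of _ "q0(e := s * b w)"], goal_cases)
    case 1
    have "q0(e := s * b w) \<in> extensional (insert e E)"
      using q0(1) by (auto simp: extensional_def)
    then show ?case
      using q0(2) restr(1) by (simp add: fun_upd_same del: fun_upd_apply)
  next
    case (2 q)
    then have "restrict q E = q0"
      using restr(2) by (intro q0_unique) auto
    then have "q e' = q0 e'" if "e' \<in> E" for e'
      using that restrict_apply'[of e' E q] by simp
    moreover have "q0(e := s * b w) \<in> extensional (insert e E)"
      using q0(1) by (auto simp: extensional_def)
    ultimately show ?case
      using 2 eE by (intro extensionalityI[of _ "insert e E"]) auto
  qed
qed

section \<open>Compositions\<close>

text \<open>
  If the value at each point is a function of the values at its predecessors in a well-founded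
  relation, well-founded recursion gives a solution and well-founded induction its uniqueness.
\<close>

lemma wf_unique_fixpoint:
  assumes "wf R" "\<And>f g x. (\<And>z. (z, x) \<in> R \<Longrightarrow> f z = g z) \<Longrightarrow> F f x = F g x"
  shows "\<exists>!f. \<forall>x. f x = F f x"
proof (rule ex_ex1I)
  have "adm_wf R F"
    using assms(2) unfolding adm_wf_def by blast
  then have "wfrec R F = F (wfrec R F)"
    by (rule wfrec_fixpoint[OF assms(1)])
  then show "\<exists>f. \<forall>x. f x = F f x"
    by (intro exI[of _ "wfrec R F"] allI) (rule fun_cong)
next
  fix f g
  assume f: "\<forall>x. f x = F f x" and g: "\<forall>x. g x = F g x"
  have "f x = g x" for x
    using assms(1)
  proof (induction x rule: wf_induct_rule)
    case (less x)
    then have "F f x = F g x"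
      by (rule assms(2))
    then show ?case using f[rule_format, of x] g[rule_format, of x] by (simp only:)
  qed
  then show "f = g" by blast
qed

definition upstream :: "('v \<times> 'v) set \<Rightarrow> ('v \<times> 'v \<Rightarrow> real) \<Rightarrow> ('v \<times> 'v) set" where
  "upstream E q = {e \<in> E. q e > 0} \<union> {e \<in> E. q e < 0}\<inverse>"

text \<open>
  A potential whose difference along each edge is the sign of the flow increases strictly in the
  direction of the flow, so the flow cannot return to a node.
\<close>

lemma grown_tree_wf_upstream:
  assumes "grown_tree V E"
  shows "wf (upstream E q)"
proof (rule finite_acyclic_wf)
  show "finite (upstream E q)"
    using grown_tree_finite_edges[OF assms] by (simp add: upstream_def)
  obtain \<phi> :: "'a \<Rightarrow> real" where \<phi>: "\<forall>e\<in>E. \<phi> (snd e) - \<phi> (fst e) = sgn (q e)"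
    using grown_tree_potential_exists[OF assms, of "\<lambda>e. sgn (q e)"] by blast
  have step: "\<phi> a < \<phi> b" if "(a, b) \<in> upstream E q" for a b
    using that \<phi> by (force simp: upstream_def)
  have "\<phi> a < \<phi> b" if "(a, b) \<in> (upstream E q)\<^sup>+" for a b
    using that by induction (auto dest: step)
  then show "acyclic (upstream E q)"
    unfolding acyclic_def by fastforce
qed

text \<open>
  An edge contributes to the mixture at \<open>v\<close> only if its flow enters \<open>v\<close>, and then it carries
  the composition of its other end, which lies upstream of \<open>v\<close>.
\<close>

lemma mixing_term_cong:
  assumes "e \<in> incident_edges N v" "\<And>z. (z, v) \<in> upstream (edges N) q \<Longrightarrow> \<eta> z = \<eta>' z"
  shows "edge_composition q \<eta> e * pos_part (incidence v e * q e) =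
    edge_composition q \<eta>' e * pos_part (incidence v e * q e)"
  using assms
  by (cases e) (force simp: incident_edges_def edge_composition_def pos_part_def incidence_def
      upstream_def)

lemma grown_tree_unique_composition:
  fixes N :: "'v gas_network"
  assumes "grown_tree (nodes N) (edges N)"
  shows "\<exists>!\<eta>. \<eta> \<in> extensional (nodes N) \<and> mixing_law N \<eta>0 q \<eta>"
proof -
  define F where "F \<eta> v = (if v \<notin> nodes N then undefined
      else if inflow N q v = 0 then \<eta>0 v
      else ((\<Sum>e\<in>incident_edges N v. edge_composition q \<eta> e * pos_part (incidence v e * q e))
            + (if v \<in> supply_nodes N
               then supply_composition N v * neg_part (load N v) else 0))
           / inflow N q v)" for \<eta> v
  have "\<eta> \<in> extensional (nodes N) \<and> mixing_law N \<eta>0 q \<eta> \<longleftrightarrow> (\<forall>v. \<eta> v = F \<eta> v)" for \<eta>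
    unfolding mixing_law_def extensional_def F_def by auto
  moreover have "\<exists>!\<eta>. \<forall>v. \<eta> v = F \<eta> v"
  proof (rule wf_unique_fixpoint[OF grown_tree_wf_upstream[OF assms, of q]])
    fix \<eta> \<eta>' :: "'v \<Rightarrow> real" and v
    assume "\<And>z. (z, v) \<in> upstream (edges N) q \<Longrightarrow> \<eta> z = \<eta>' z"
    then have "(\<Sum>e\<in>incident_edges N v. edge_composition q \<eta> e * pos_part (incidence v e * q e)) =
        (\<Sum>e\<in>incident_edges N v. edge_composition q \<eta>' e * pos_part (incidence v e * q e))"
      by (intro sum.cong refl mixing_term_cong)
    then show "F \<eta> v = F \<eta>' v"
      by (simp add: F_def)
  qed
  ultimately show ?thesis by simp
qed

section \<open>The gas flow model\<close>

lemma well_posed_tree_grown: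
  assumes "well_posed_network N" "tree_shaped (graph N)"
  shows "grown_tree (nodes N) (edges N)"
  using assms grown_tree_if_connected_tree_shaped[of "graph N" "ref_node N"]
  unfolding well_posed_network_def by blast

lemma mass_balance_all_edges:
  assumes "finite (edges N)"
  shows "mass_balance N q \<longleftrightarrow> (\<forall>v\<in>nodes N. (\<Sum>e\<in>edges N. incidence v e * q e) = load N v)"
proof -
  have "(\<Sum>e\<in>incident_edges N v. incidence v e * q e) = (\<Sum>e\<in>edges N. incidence v e * q e)" for v
    using assms by (intro sum.mono_neutral_left) (auto simp: incident_edges_def incidence_def)
  then show ?thesis
    by (simp add: mass_balance_def)
qed

text \<open>
  The flows, the compositions and the differences of the squared pressures do not depend on the
  prescribed pressure, which therefore enters the squared pressures only as a constant.
\<close>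

lemma squared_solutions_shift:
  assumes "well_posed_network N" "tree_shaped (graph N)"
  obtains \<psi> q \<eta> where "\<psi> (ref_node N) = 0"
    "\<forall>pstar s. steady_state_squared N \<eta>0 pstar s \<longleftrightarrow> s = (q, \<eta>, \<lambda>v\<in>nodes N. pstar\<^sup>2 + \<psi> v)"
proof -
  have grown: "grown_tree (nodes N) (edges N)"
    using assms by (rule well_posed_tree_grown)
  have ref: "ref_node N \<in> nodes N" and bal: "(\<Sum>v\<in>nodes N. load N v) = 0"
    using assms by (auto simp: well_posed_network_def)
  obtain q where q: "\<And>q'. q' \<in> extensional (edges N) \<and> mass_balance N q' \<longleftrightarrow> q' = q"
    using grown_tree_unique_flow[OF grown bal]
    unfolding mass_balance_all_edges[OF grown_tree_finite_edges[OF grown]] by metis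
  obtain \<eta> where \<eta>: "\<And>\<eta>'. \<eta>' \<in> extensional (nodes N) \<and> mixing_law N \<eta>0 q \<eta>' \<longleftrightarrow> \<eta>' = \<eta>"
    using grown_tree_unique_composition[OF grown, of \<eta>0 q] by metis
  define d where "d e = sigma_tilde N e (\<eta> (fst e)) (\<eta> (snd e)) (q e) * (q e * \<bar>q e\<bar>)" for e
  note potential = grown_tree_unique_potential[OF grown ref, of _ d]
  obtain \<psi> where \<psi>: "\<psi> (ref_node N) = 0" "\<forall>e\<in>edges N. \<psi> (snd e) - \<psi> (fst e) = d e"
    using potential[of 0] by blast
  have "steady_state_squared N \<eta>0 pstar s \<longleftrightarrow> s = (q, \<eta>, \<lambda>v\<in>nodes N. pstar\<^sup>2 + \<psi> v)" for pstar s
  proof -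
    obtain q' \<eta>' P where s: "s = (q', \<eta>', P)" by (cases s)
    define sol where "sol = (\<lambda>v\<in>nodes N. pstar\<^sup>2 + \<psi> v)"
    have "fst e \<in> nodes N \<and> snd e \<in> nodes N" if "e \<in> edges N" for e
      using grown_tree_edges_subset[OF grown] that by auto
    then have sol: "sol \<in> extensional (nodes N) \<and> sol (ref_node N) = pstar\<^sup>2 \<and>
        (\<forall>e\<in>edges N. sol (snd e) - sol (fst e) = d e)"
      using \<psi> ref by (simp add: sol_def)
    have pressure: "P \<in> extensional (nodes N) \<and> P (ref_node N) = pstar\<^sup>2 \<and>
        pressure_law N q \<eta> P \<longleftrightarrow> P = sol"
      using potential[of "pstar\<^sup>2"] sol
      unfolding pressure_law_def d_def by metis
    have "steady_state_squared N \<eta>0 pstar s \<longleftrightarrow>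
        (q' \<in> extensional (edges N) \<and> mass_balance N q') \<and>
        (\<eta>' \<in> extensional (nodes N) \<and> mixing_law N \<eta>0 q' \<eta>') \<and>
        (P \<in> extensional (nodes N) \<and> P (ref_node N) = pstar\<^sup>2 \<and> pressure_law N q' \<eta>' P)"
      unfolding steady_state_squared_def s by auto
    also have "\<dots> \<longleftrightarrow> q' = q \<and> \<eta>' = \<eta> \<and> P = sol"
      using q \<eta> pressure by metis
    finally show ?thesis
      by (simp add: s sol_def)
  qed
  with \<psi>(1) that show ?thesis by blast
qed

lemma steady_state_iff_squared:
  assumes "grown_tree (nodes N) (edges N)" "ref_node N \<in> nodes N"
  shows "steady_state N \<eta>0 pstar (q, \<eta>, p) \<longleftrightarrow>
    p \<in> extensional (nodes N) \<and> (\<forall>v\<in>nodes N. p v \<ge> 0) \<and> p (ref_node N) = pstar \<and>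
    steady_state_squared N \<eta>0 pstar (q, \<eta>, \<lambda>v\<in>nodes N. (p v)\<^sup>2)"
proof -
  have "fst e \<in> nodes N \<and> snd e \<in> nodes N" if "e \<in> edges N" for e
    using grown_tree_edges_subset[OF assms(1)] that by auto
  then have "pressure_law N q \<eta> (\<lambda>v\<in>nodes N. (p v)\<^sup>2) \<longleftrightarrow> pressure_law N q \<eta> (\<lambda>v. (p v)\<^sup>2)"
    unfolding pressure_law_def by auto
  then show ?thesis
    unfolding steady_state_def steady_state_squared_def using assms(2) by auto
qed

theorem theorem3p5:
  fixes N :: "'v gas_network" and \<eta>0 :: "'v \<Rightarrow> real"
  assumes "well_posed_network N"
    and "tree_shaped (graph N)"
  shows "(\<forall>pstar. \<exists>!s. steady_state_squared N \<eta>0 pstar s) \<and>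
         (\<exists>pmin\<ge>0. \<forall>pstar.
            (pstar \<ge> pmin \<longrightarrow> (\<exists>!s. steady_state N \<eta>0 pstar s)) \<and>
            (pstar < pmin \<longrightarrow> \<not> (\<exists>s. steady_state N \<eta>0 pstar s)))"
proof
  let ?r = "ref_node N"
  have grown: "grown_tree (nodes N) (edges N)"
    using assms by (rule well_posed_tree_grown)
  note finV = grown_tree_finite_nodes[OF grown]
  have ref: "?r \<in> nodes N"
    using assms by (auto simp: well_posed_network_def)
  obtain \<psi> q \<eta> where \<psi>: "\<psi> ?r = 0" and shift:
    "\<forall>pstar s. steady_state_squared N \<eta>0 pstar s \<longleftrightarrow> s = (q, \<eta>, \<lambda>v\<in>nodes N. pstar\<^sup>2 + \<psi> v)"
    by (rule squared_solutions_shift[OF assms, of \<eta>0])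
  note squared = shift[rule_format]
  show "\<forall>pstar. \<exists>!s. steady_state_squared N \<eta>0 pstar s"
    by (intro allI ex1I) (rule squared[THEN iffD2, OF refl], rule squared[THEN iffD1])

  have solution: "steady_state N \<eta>0 pstar (q', \<eta>', p) \<longleftrightarrow> q' = q \<and> \<eta>' = \<eta> \<and>
      p \<in> extensional (nodes N) \<and> p ?r = pstar \<and>
      (\<forall>v\<in>nodes N. p v \<ge> 0 \<and> (p v)\<^sup>2 = pstar\<^sup>2 + \<psi> v)" for pstar q' \<eta>' p
  proof -
    have "(\<lambda>v\<in>nodes N. (p v)\<^sup>2) = (\<lambda>v\<in>nodes N. pstar\<^sup>2 + \<psi> v) \<longleftrightarrow>
        (\<forall>v\<in>nodes N. (p v)\<^sup>2 = pstar\<^sup>2 + \<psi> v)"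
      by (simp add: fun_eq_iff Ball_def)
    then show ?thesis
      unfolding steady_state_iff_squared[OF grown ref] squared prod.inject
      by (simp add: ball_conj_distrib conj_ac)
  qed

  define m where "m = Max ((\<lambda>v. - \<psi> v) ` nodes N)"
  have m_upper: "- \<psi> v \<le> m" if "v \<in> nodes N" for v
    using that finV by (simp add: m_def)
  have m_attained: "\<exists>v\<in>nodes N. m = - \<psi> v"
    using Max_in[of "(\<lambda>v. - \<psi> v) ` nodes N"] finV ref unfolding m_def by blast
  \<comment> \<open>the reference node itself forces the threshold to be nonnegative\<close>
  have m0: "m \<ge> 0"
    using m_upper[OF ref] \<psi> by simp
  show "\<exists>pmin\<ge>0. \<forall>pstar. (pstar \<ge> pmin \<longrightarrow> (\<exists>!s. steady_state N \<eta>0 pstar s)) \<and>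
      (pstar < pmin \<longrightarrow> \<not> (\<exists>s. steady_state N \<eta>0 pstar s))"
  proof (intro exI[of _ "sqrt m"] conjI allI impI)
    show "sqrt m \<ge> 0" using m0 by simp
  next
    fix pstar
    assume large: "sqrt m \<le> pstar"
    have p0: "pstar \<ge> 0" using real_sqrt_ge_zero[OF m0] large by (rule order_trans)
    have "m \<le> pstar\<^sup>2" using large by (rule sqrt_le_D)
    then have nonneg: "pstar\<^sup>2 + \<psi> v \<ge> 0" if "v \<in> nodes N" for v
      using m_upper[OF that] by linarith
    define p where "p = (\<lambda>v\<in>nodes N. sqrt (pstar\<^sup>2 + \<psi> v))"
    have "steady_state N \<eta>0 pstar (q, \<eta>, p)"
      unfolding solution using nonneg p0 \<psi> ref by (auto simp: p_def)
    moreover have "s = (q, \<eta>, p)" if s: "steady_state N \<eta>0 pstar s" for s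
    proof -
      obtain q' \<eta>' p' where s_eq: "s = (q', \<eta>', p')" by (cases s)
      note sol = s[unfolded s_eq solution]
      have "p' = p"
      proof (rule extensionalityI[of _ "nodes N"])
        show "p' v = p v" if "v \<in> nodes N" for v
          using sol that real_sqrt_unique[of "p' v" "pstar\<^sup>2 + \<psi> v"] by (simp add: p_def)
      qed (use sol in \<open>auto simp: p_def\<close>)
      with sol s_eq show ?thesis by simp
    qed
    ultimately show "\<exists>!s. steady_state N \<eta>0 pstar s" by blast
  next
    fix pstar
    assume small: "pstar < sqrt m"
    show "\<not> (\<exists>s. steady_state N \<eta>0 pstar s)"
    proof
      assume "\<exists>s. steady_state N \<eta>0 pstar s"
      then obtain p where p: "p ?r = pstar"
        "\<forall>v\<in>nodes N. p v \<ge> 0 \<and> (p v)\<^sup>2 = pstar\<^sup>2 + \<psi> v"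
        by (auto simp: solution)
      then have "pstar \<ge> 0" using ref by blast
      with small have "pstar\<^sup>2 < (sqrt m)\<^sup>2"
        by (intro power_strict_mono) simp_all
      then have "pstar\<^sup>2 < m"
        using m0 by simp
      moreover obtain v where "v \<in> nodes N" "m = - \<psi> v"
        using m_attained by blast
      ultimately have "(p v)\<^sup>2 < 0" using p(2) by simp
      then show False by simp
    qed
  qed
qed

end
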